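(* The set of positive integers $n$ that are $s$-practical and satisfy $n^{1/2}\le S_s(n)$ has asymptotic density $0$.
   Context: $s(n)=\sigma(n)-n$ is the sum of proper divisors of $n$, and $S_s(n)=\sum_{d\mid n}s(d)$. A positive integer $n$ is $s$-practical if every positive integer $m\le S_s(n)$ equals $\sum_{d\in\mathcal{D}}s(d)$ for some set $\mathcal{D}$ of distinct positive divisors of $n$. *)

theory Defs
  imports Complex_Main
begin

definition divsum :: "nat \<Rightarrow> nat" where
  "divsum n = (\<Sum>d\<in>{d. d dvd n}. d)"

definition s_fun :: "nat \<Rightarrow> nat" where
  "s_fun n = divsum n - n"

definition S_s :: "nat \<Rightarrow> nat" where
  "S_s n = (\<Sum>d\<in>{d. d dvd n}. s_fun d)"

definition s_practical :: "nat \<Rightarrow> bool" where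
  "s_practical n \<longleftrightarrow>
     (\<forall>m. 1 \<le> m \<and> m \<le> S_s n \<longrightarrow>
        (\<exists>D. D \<subseteq> {d. 0 < d \<and> d dvd n} \<and> m = (\<Sum>d\<in>D. s_fun d)))"

end

theory Submission
  imports Defs "HOL-Analysis.Harmonic_Numbers" "HOL-Computational_Algebra.Primes"
    "HOL-Real_Asymp.Real_Asymp"
begin

text \<open>
  Write \<open>\<tau>(n)\<close> for the number of divisors of \<open>n\<close>. An \<open>s\<close>-practical \<open>n\<close> has \<open>S_s(n) \<le> 2\<^bsup>\<tau>(n)\<^esup>\<close>,
  so \<open>\<surd>n \<le> S_s(n)\<close> forces \<open>\<tau>(n) \<ge> (ln n) / 2\<close>, and it suffices that \<open>\<tau>(n) \<ge> c ln n\<close> holds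
  only on a set of density zero. The average of \<open>\<tau>\<close> is \<open>ln n\<close> itself, so Markov's inequality alone
  is not enough. Fix a finite set \<open>P\<close> of odd primes and bound \<open>\<tau>(n) \<le> F(n)\<^sup>2 B(n)\<close>, where \<open>B(n)\<close> counts
  the divisors of \<open>n\<close> free of primes in \<open>P\<close> and \<open>F(n) = \<Prod>\<^sub>p (1 + 5/12 v\<^sub>p(n))\<close> over \<open>p \<in> P\<close>. Then
  \<open>F\<close> has mean at most \<open>A = \<Prod>\<^sub>p (1 + 5/12 / (p - 1))\<close> and \<open>B\<close> has mean asymptotically at most
  \<open>\<alpha> ln x\<close> with \<open>\<alpha> = \<Prod>\<^sub>p (1 - 1/p)\<close>. Markov's inequality for \<open>F\<close> and \<open>B\<close> separately yields an
  arbitrarily small upper density as soon as \<open>A\<^sup>2 \<alpha>\<close> is small. Its factors are at most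
  \<open>1 - 1/(13 p)\<close>, so this follows from the divergence of the sum of \<open>1/p\<close>. The constant \<open>5/12\<close> is
  chosen between \<open>\<surd>2 - 1\<close>, which gives \<open>1 + k \<le> (1 + 5/12 k)\<^sup>2\<close> for all natural \<open>k\<close>, and \<open>1/2\<close>.
\<close>

section \<open>Sums over multiples of q\<close>

lemma sum_multiples:
  fixes f :: "nat \<Rightarrow> 'a::comm_monoid_add"
  assumes "q > 0"
  shows "(\<Sum>n | n \<in> {1..x} \<and> q dvd n. f n) = (\<Sum>m\<in>{1..x div q}. f (q * m))"
proof -
  have "{n. n \<in> {1..x} \<and> q dvd n} = (*) q ` {1..x div q}"
  proof (intro equalityI subsetI)
    fix n assume "n \<in> {n. n \<in> {1..x} \<and> q dvd n}"
    then obtain m where m: "n = q * m" "1 \<le> n" "n \<le> x" by (auto elim: dvdE)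
    hence "m \<le> x div q" using assms by (simp add: less_eq_div_iff_mult_less_eq mult.commute)
    moreover have "1 \<le> m" using m by (cases m) auto
    ultimately show "n \<in> (*) q ` {1..x div q}" using m by (intro image_eqI[of _ _ m]) auto
  next
    fix n assume "n \<in> (*) q ` {1..x div q}"
    then obtain m where m: "n = q * m" "1 \<le> m" "m \<le> x div q" by (metis imageE atLeastAtMost_iff)
    hence "q * m \<le> x" using assms by (simp add: less_eq_div_iff_mult_less_eq mult.commute)
    thus "n \<in> {n. n \<in> {1..x} \<and> q dvd n}" using m assms by simp
  qed
  moreover have "inj_on ((*) q) {1..x div q}" using assms by (auto simp: inj_on_def)
  ultimately show ?thesis by (simp add: sum.reindex)
qed

text \<open>Peeling off the multiples of one prime turns a sum up to \<open>x\<close> into a sum up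
  to \<open>x div q\<close>. The inductions on the set of primes below rest on the recursions
  obtained this way.\<close>

lemma sum_split_multiples:
  fixes f :: "nat \<Rightarrow> real"
  assumes "q > 0"
  shows "(\<Sum>n\<in>{1..x}. f n) =
    (\<Sum>n | n \<in> {1..x} \<and> \<not> q dvd n. f n) + (\<Sum>m\<in>{1..x div q}. f (q * m))"
proof -
  have "{1..x} = {n. n \<in> {1..x} \<and> \<not> q dvd n} \<union> {n. n \<in> {1..x} \<and> q dvd n}" by auto
  hence "(\<Sum>n\<in>{1..x}. f n) =
      (\<Sum>n\<in>{n. n \<in> {1..x} \<and> \<not> q dvd n} \<union> {n. n \<in> {1..x} \<and> q dvd n}. f n)"
    by (rule arg_cong)
  also have "\<dots> = (\<Sum>n | n \<in> {1..x} \<and> \<not> q dvd n. f n) + (\<Sum>n | n \<in> {1..x} \<and> q dvd n. f n)"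
    by (rule sum.union_disjoint) auto
  finally show ?thesis using sum_multiples[OF assms, of f x] by simp
qed

section \<open>Divergence of the sum of 1/p over odd primes\<close>

text \<open>A truncated Euler product. Pulling one factor q out of the multiples of q gives
  \<open>T (insert q P) \<le> T P + T (insert q P) / q\<close>, which is then solved for
  \<open>T (insert q P)\<close>; no infinite series is involved.\<close>

lemma sum_inverse_smooth_le:
  fixes P :: "nat set"
  assumes "finite P" "\<And>p. p \<in> P \<Longrightarrow> prime p"
  shows "(\<Sum>n | n \<in> {1..N} \<and> (\<forall>p. prime p \<and> p dvd n \<longrightarrow> p \<in> P). 1 / real n)
           \<le> (\<Prod>p\<in>P. 1 / (1 - 1 / real p))"
  using assms
proof (induction P rule: finite_induct)
  case empty
  have "{n. n \<in> {1..N} \<and> (\<forall>p. prime p \<and> p dvd n \<longrightarrow> p \<in> {})} \<subseteq> {1}"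
    using prime_factor_nat by auto
  hence "(\<Sum>n | n \<in> {1..N} \<and> (\<forall>p. prime p \<and> p dvd n \<longrightarrow> p \<in> {}). 1 / real n)
     \<le> (\<Sum>n\<in>{1}. 1 / real n)" by (intro sum_mono2) auto
  thus ?case by simp
next
  case (insert q P)
  have q: "prime q" using insert by auto
  hence q1: "q > 1" by (rule prime_gt_1_nat)
  define S where "S = (\<lambda>R. {n::nat. \<forall>p. prime p \<and> p dvd n \<longrightarrow> p \<in> R})"
  define T where "T = (\<lambda>R. \<Sum>n\<in>{1..N}. if n \<in> S R then 1 / real n else 0)"
  have T: "(\<Sum>n | n \<in> {1..N} \<and> (\<forall>p. prime p \<and> p dvd n \<longrightarrow> p \<in> R). 1 / real n) = T R" for R
    unfolding T_def S_def by (subst sum.inter_filter[symmetric]) (auto intro!: sum.cong)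
  have "T (insert q P) = (\<Sum>n | n \<in> {1..N} \<and> \<not> q dvd n. if n \<in> S (insert q P) then 1 / real n else 0)
     + (\<Sum>m\<in>{1..N div q}. if q * m \<in> S (insert q P) then 1 / real (q * m) else 0)"
    unfolding T_def using q1 by (intro sum_split_multiples) auto
  also have "(\<Sum>n | n \<in> {1..N} \<and> \<not> q dvd n. if n \<in> S (insert q P) then 1 / real n else 0)
     \<le> (\<Sum>n | n \<in> {1..N} \<and> \<not> q dvd n. if n \<in> S P then 1 / real n else 0)"
    by (intro sum_mono) (auto simp: S_def)
  also have "\<dots> \<le> T P" unfolding T_def by (intro sum_mono2) auto
  also have "(\<Sum>m\<in>{1..N div q}. if q * m \<in> S (insert q P) then 1 / real (q * m) else 0)
     \<le> (\<Sum>m\<in>{1..N div q}. (1 / q) * (if m \<in> S (insert q P) then 1 / real m else 0))"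
    by (intro sum_mono) (auto simp: S_def mult.commute)
  also have "\<dots> \<le> (\<Sum>m\<in>{1..N}. (1 / q) * (if m \<in> S (insert q P) then 1 / real m else 0))"
  proof (intro sum_mono2)
    show "{1..N div q} \<subseteq> {1..N}" using div_le_dividend[of N q] by auto
  qed auto
  also have "\<dots> = (1 / q) * T (insert q P)" unfolding T_def by (simp add: sum_distrib_left)
  finally have "T (insert q P) * (1 - 1 / q) \<le> T P" by (simp add: algebra_simps)
  hence "T (insert q P) \<le> T P * (1 / (1 - 1 / q))" using q1 by (simp add: field_simps)
  also have "\<dots> \<le> (\<Prod>p\<in>P. 1 / (1 - 1 / real p)) * (1 / (1 - 1 / q))"
    using insert T[of P] q1 by (intro mult_right_mono) auto
  finally show ?case unfolding T using insert by (simp add: mult.commute)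
qed

text \<open>Euler's argument: every n up to N has all its prime factors up to N, so the harmonic sum
  is at most the Euler product over these primes. A bounded sum of 1/p would bound that product,
  against the growth of \<open>ln (N + 1)\<close>.\<close>

lemma sum_inverse_odd_primes_unbounded:
  "\<exists>N. K < (\<Sum>p | prime p \<and> p \<noteq> 2 \<and> p \<le> N. 1 / real p)"
proof (rule ccontr)
  assume "\<not> ?thesis"
  hence le: "(\<Sum>p | prime p \<and> p \<noteq> 2 \<and> p \<le> N. 1 / real p) \<le> K" for N by (meson not_less)
  have bound: "ln (real N + 1) \<le> exp (1 + 2 * K)" for N :: nat
  proof -
    let ?Q = "{p. prime p \<and> p \<le> N}"
    have "ln (real N + 1) \<le> harm N" by (rule ln_le_harm)
    also have "\<dots> = (\<Sum>n | n \<in> {1..N} \<and> (\<forall>p. prime p \<and> p dvd n \<longrightarrow> p \<in> ?Q). 1 / real n)"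
      unfolding harm_def
      by (intro sum.cong) (auto simp: field_simps dest!: dvd_imp_le)
    also have "\<dots> \<le> (\<Prod>p\<in>?Q. 1 / (1 - 1 / real p))"
      by (intro sum_inverse_smooth_le) auto
    also have "\<dots> \<le> (\<Prod>p\<in>?Q. exp (2 / real p))"
    proof (intro prod_mono conjI)
      fix p assume "p \<in> ?Q"
      hence p: "real p \<ge> 2" using prime_ge_2_nat[of p] by simp
      thus "0 \<le> 1 / (1 - 1 / real p)" by simp
      have "1 / (1 - 1 / real p) \<le> 1 + 2 / real p" using p by (simp add: field_simps)
      also have "\<dots> \<le> exp (2 / real p)" by (rule exp_ge_add_one_self)
      finally show "1 / (1 - 1 / real p) \<le> exp (2 / real p)" .
    qed
    also have "\<dots> = exp (\<Sum>p\<in>?Q. 2 / real p)" by (simp add: exp_sum)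
    \<comment> \<open>The prime 2 contributes 2/2 = 1. Inserting it unconditionally also covers N <
      2, hence an inequality.\<close>
    also have "(\<Sum>p\<in>?Q. 2 / real p) \<le>
        (\<Sum>p\<in>insert 2 {p. prime p \<and> p \<noteq> 2 \<and> p \<le> N}. 2 / real p)"
      by (intro sum_mono2) auto
    also have "\<dots> = 1 + 2 * (\<Sum>p | prime p \<and> p \<noteq> 2 \<and> p \<le> N. 1 / real p)"
      by (simp add: sum_distrib_left)
    also have "\<dots> \<le> 1 + 2 * K" using le[of N] by simp
    finally show ?thesis by simp
  qed
  have "filterlim (\<lambda>N::nat. ln (real N + 1)) at_top at_top" by real_asymp
  hence "\<forall>\<^sub>F N::nat in at_top. exp (1 + 2 * K) < ln (real N + 1)"
    by (simp add: filterlim_at_top_dense)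
  then obtain N :: nat where "exp (1 + 2 * K) < ln (real N + 1)"
    by (meson eventually_happens trivial_limit_sequentially)
  thus False using bound[of N] by simp
qed

section \<open>Mean value of the multiplicity product F\<close>

text \<open>The multiplicity of q has mean at most 1/(q - 1), and weighting by the product over the
  other primes does not disturb this, since that product takes the same value at
  \<open>q * m\<close> and at \<open>m\<close>.\<close>

lemma sum_prod_multiplicity_le:
  fixes P :: "nat set" and c :: real
  assumes "finite P" "\<And>p. p \<in> P \<Longrightarrow> prime p" "c \<ge> 0"
  shows "(\<Sum>n\<in>{1..x}. \<Prod>p\<in>P. 1 + c * real (multiplicity p n))
           \<le> real x * (\<Prod>p\<in>P. 1 + c / (real p - 1))"
  using assms
proof (induction P arbitrary: x rule: finite_induct)
  case empty
  show ?case by simp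
next
  case (insert q P)
  have q: "prime q" using insert by auto
  hence q1: "q > 1" by (rule prime_gt_1_nat)
  define F where "F = (\<lambda>n. \<Prod>p\<in>P. 1 + c * real (multiplicity p n))"
  define A where "A = (\<Prod>p\<in>P. 1 + c / (real p - 1))"
  have A0: "A \<ge> 0" unfolding A_def
  proof (intro prod_nonneg)
    fix p assume "p \<in> P"
    hence "p \<ge> 2" using insert prime_ge_2_nat by auto
    thus "0 \<le> 1 + c / (real p - 1)" using \<open>c \<ge> 0\<close> by simp
  qed
  have F: "(\<Sum>n\<in>{1..x}. F n) \<le> real x * A" for x
    unfolding F_def A_def using insert by auto
  have Fq: "F (q * m) = F m" if "m > 0" for m
    unfolding F_def
  proof (intro prod.cong refl)
    fix p assume p: "p \<in> P"
    have "multiplicity p q = 0"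
      using p q insert by (intro not_dvd_imp_multiplicity_0) (metis insertCI primes_dvd_imp_eq)
    moreover have "multiplicity p (q * m) = multiplicity p q + multiplicity p m"
      using p q1 insert that by (intro prime_elem_multiplicity_mult_distrib) auto
    ultimately show "1 + c * real (multiplicity p (q * m)) = 1 + c * real (multiplicity p m)"
      by simp
  qed
  define W where "W = (\<lambda>x. \<Sum>n\<in>{1..x}. F n * real (multiplicity q n))"
  \<comment> \<open>Only multiples of q contribute, so \<open>W x\<close> equals
    \<open>W (x div q)\<close> plus the sum of \<open>F\<close> up to \<open>x div q\<close>. The
    constant 1/(q - 1) is the solution of w = w/q + 1/q.\<close>
  have W: "W x \<le> real x * A / (real q - 1)" for x
  proof (induction x rule: less_induct)
    case (less x)
    show ?case
    proof (cases "x = 0")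
      case True
      thus ?thesis by (simp add: W_def)
    next
      case False
      have "W x = (\<Sum>n | n \<in> {1..x} \<and> \<not> q dvd n. F n * real (multiplicity q n))
         + (\<Sum>m\<in>{1..x div q}. F (q * m) * real (multiplicity q (q * m)))"
        unfolding W_def using q1 by (intro sum_split_multiples) auto
      also have "(\<Sum>n | n \<in> {1..x} \<and> \<not> q dvd n. F n * real (multiplicity q n)) = 0"
        by (intro sum.neutral) (auto simp: not_dvd_imp_multiplicity_0)
      also have "(\<Sum>m\<in>{1..x div q}. F (q * m) * real (multiplicity q (q * m)))
         = (\<Sum>m\<in>{1..x div q}. F m * real (multiplicity q m) + F m)"
      proof (intro sum.cong refl)
        fix m assume "m \<in> {1..x div q}"
        hence m: "m > 0" by simp
        have "multiplicity q (q * m) = Suc (multiplicity q m)"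
          using m q1 by (intro multiplicity_times_same) auto
        thus "F (q * m) * real (multiplicity q (q * m)) = F m * real (multiplicity q m) + F m"
          using Fq[OF m] by (simp add: algebra_simps)
      qed
      also have "\<dots> = W (x div q) + (\<Sum>m\<in>{1..x div q}. F m)"
        by (simp add: W_def sum.distrib)
      also have "\<dots> \<le> real (x div q) * A / (real q - 1) + real (x div q) * A"
        using less[of "x div q"] False q1 F by (intro add_mono) auto
      also have "\<dots> = real (x div q) * (A * real q / (real q - 1))"
        using q1 by (simp add: field_simps)
      also have "\<dots> \<le> (real x / real q) * (A * real q / (real q - 1))"
        using A0 q1 by (intro mult_right_mono of_nat_div_le_of_nat) auto
      also have "\<dots> = real x * A / (real q - 1)" using q1 by simp
      finally show ?thesis by simp
    qed
  qed
  have "(\<Sum>n\<in>{1..x}. \<Prod>p\<in>insert q P. 1 + c * real (multiplicity p n))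
     = (\<Sum>n\<in>{1..x}. F n) + c * W x"
    using insert by (simp add: F_def W_def sum_distrib_left sum.distrib algebra_simps)
  also have "\<dots> \<le> real x * A + c * (real x * A / (real q - 1))"
    using F W \<open>c \<ge> 0\<close> by (intro add_mono mult_left_mono) auto
  also have "\<dots> = real x * (A * (1 + c / (real q - 1)))" by (simp add: algebra_simps)
  also have "\<dots> = real x * (\<Prod>p\<in>insert q P. 1 + c / (real p - 1))"
    using insert by (simp add: A_def)
  finally show ?case .
qed

section \<open>Divisors free of primes in P\<close>

text \<open>Sieving out one more prime q subtracts \<open>H P (x div q) / q\<close> from
  \<open>H P x\<close>. Since \<open>ln (x div q)\<close> is asymptotic to \<open>ln x\<close>, the
  limit is multiplied by 1 - 1/q. The case of no primes is the asymptotics of the harmonic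
  numbers.\<close>

lemma sum_inverse_rough_asymp:
  fixes P :: "nat set"
  assumes "finite P" "\<And>p. p \<in> P \<Longrightarrow> prime p"
  shows "(\<lambda>x. (\<Sum>n | n \<in> {1..x} \<and> (\<forall>p\<in>P. \<not> p dvd n). 1 / real n) / ln (real x))
           \<longlonglongrightarrow> (\<Prod>p\<in>P. 1 - 1 / real p)"
  using assms
proof (induction P rule: finite_induct)
  case empty
  have "(\<lambda>x. (harm x - ln (real x)) / ln (real x) + 1) \<longlonglongrightarrow> 0 + 1"
  proof (intro tendsto_add tendsto_const)
    have "filterlim (\<lambda>x. ln (real x)) at_top sequentially" by real_asymp
    thus "(\<lambda>x. (harm x - ln (real x)) / ln (real x)) \<longlonglongrightarrow> 0"
      by (intro tendsto_divide_0[OF euler_mascheroni_LIMSEQ] filterlim_at_top_imp_at_infinity)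
  qed
  moreover have "\<forall>\<^sub>F x in sequentially. (harm x - ln (real x)) / ln (real x) + 1
      = (\<Sum>n | n \<in> {1..x} \<and> (\<forall>p\<in>{}. \<not> p dvd n). 1 / real n) / ln (real x)"
    using eventually_gt_at_top[of 1]
    by eventually_elim (simp add: harm_def field_simps atLeastAtMost_def atLeast_def atMost_def Int_def)
  ultimately have "(\<lambda>x. (\<Sum>n | n \<in> {1..x} \<and> (\<forall>p\<in>{}. \<not> p dvd n). 1 / real n) / ln (real x))
      \<longlonglongrightarrow> 0 + 1"
    by (rule Lim_transform_eventually)
  thus ?case by (simp only: add_0 prod.empty)
next
  case (insert q P)
  have q: "prime q" using insert by auto
  hence q1: "q > 1" by (rule prime_gt_1_nat)
  define H where "H = (\<lambda>R x. \<Sum>n\<in>{1..x}. if \<forall>p\<in>R. \<not> p dvd n then 1 / real n else 0)"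
  have H: "(\<Sum>n | n \<in> {1..x} \<and> (\<forall>p\<in>R. \<not> p dvd n). 1 / real n) = H R x" for R and x :: nat
    unfolding H_def by (subst sum.inter_filter[symmetric]) (auto intro!: sum.cong)
  have rec: "H (insert q P) x = H P x - (1 / q) * H P (x div q)" for x
  proof -
    have "H P x = (\<Sum>n | n \<in> {1..x} \<and> \<not> q dvd n. if \<forall>p\<in>P. \<not> p dvd n then 1 / real n else 0)
       + (\<Sum>m\<in>{1..x div q}. if \<forall>p\<in>P. \<not> p dvd q * m then 1 / real (q * m) else 0)"
      unfolding H_def using q1 by (intro sum_split_multiples) auto
    also have "(\<Sum>n | n \<in> {1..x} \<and> \<not> q dvd n. if \<forall>p\<in>P. \<not> p dvd n then 1 / real n else 0)
       = (\<Sum>n\<in>{1..x}. if \<not> q dvd n then if \<forall>p\<in>P. \<not> p dvd n then 1 / real n else 0 else 0)"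
      by (subst sum.inter_filter[symmetric]) auto
    also have "\<dots> = H (insert q P) x" unfolding H_def by (intro sum.cong) auto
    also have "(\<Sum>m\<in>{1..x div q}. if \<forall>p\<in>P. \<not> p dvd q * m then 1 / real (q * m) else 0)
       = (1 / q) * H P (x div q)"
      unfolding H_def sum_distrib_left
    proof (intro sum.cong refl)
      fix m
      have "p dvd q * m \<longleftrightarrow> p dvd m" if "p \<in> P" for p
      proof -
        have "prime p" "p \<noteq> q" using that insert by auto
        moreover from this have "\<not> p dvd q" using q by (metis primes_dvd_imp_eq)
        ultimately show ?thesis by (simp add: prime_dvd_mult_iff)
      qed
      thus "(if \<forall>p\<in>P. \<not> p dvd q * m then 1 / real (q * m) else 0) =
         1 / real q * (if \<forall>p\<in>P. \<not> p dvd m then 1 / real m else 0)" by simp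
    qed
    finally show ?thesis by simp
  qed
  define \<alpha> where "\<alpha> = (\<Prod>p\<in>P. 1 - 1 / real p)"
  have IH: "(\<lambda>x. H P x / ln (real x)) \<longlonglongrightarrow> \<alpha>"
    using insert unfolding H \<alpha>_def by auto
  have divq: "filterlim (\<lambda>x. x div q) at_top sequentially"
    unfolding filterlim_at_top
  proof
    fix Z
    show "\<forall>\<^sub>F x in sequentially. Z \<le> x div q"
      using eventually_ge_at_top[of "Z * q"]
      by eventually_elim (use q1 in \<open>simp add: less_eq_div_iff_mult_less_eq\<close>)
  qed
  have lnq: "(\<lambda>x. ln (real (x div q)) / ln (real x)) \<longlonglongrightarrow> 1"
  proof (rule tendsto_sandwich)
    show "(\<lambda>x. ln (real x / real q - 1) / ln (real x)) \<longlonglongrightarrow> 1"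
      using q1 by real_asymp
    show "(\<lambda>x::nat. 1::real) \<longlonglongrightarrow> 1" by simp
    show "\<forall>\<^sub>F x in sequentially. ln (real x / real q - 1) / ln (real x) \<le> ln (real (x div q)) / ln (real x)"
      using eventually_gt_at_top[of "q + q"]
    proof eventually_elim
      case (elim x)
      have "real x / real q > 1" using elim q1 by (simp add: field_simps)
      moreover have "real x / real q - 1 \<le> real (x div q)"
        using floor_divide_of_nat_eq[of x q, where ?'a = real] by linarith
      ultimately have "ln (real x / real q - 1) \<le> ln (real (x div q))"
        by (subst ln_le_cancel_iff) linarith+
      thus ?case using elim by (intro divide_right_mono) auto
    qed
    show "\<forall>\<^sub>F x in sequentially. ln (real (x div q)) / ln (real x) \<le> 1"
      using eventually_gt_at_top[of "q + q"]
    proof eventually_elim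
      case (elim x)
      have "x div q > 0" using elim q1 by (simp add: div_greater_zero_iff)
      hence "ln (real (x div q)) \<le> ln (real x)" using elim by simp
      moreover have "ln (real x) > 0" using elim q1 by simp
      ultimately show ?case by simp
    qed
  qed
  have "(\<lambda>x. H P (x div q) / ln (real (x div q)) * (ln (real (x div q)) / ln (real x))) \<longlonglongrightarrow> \<alpha> * 1"
    using filterlim_compose[OF IH divq] lnq by (intro tendsto_mult)
  moreover have "\<forall>\<^sub>F x in sequentially. H P (x div q) / ln (real (x div q)) * (ln (real (x div q)) / ln (real x))
      = H P (x div q) / ln (real x)"
    \<comment> \<open>From here on \<open>x div q\<close> is at least 2, so its logarithm is nonzero
      and cancels.\<close>
    using eventually_ge_at_top[of "2 * q"]
  proof eventually_elim
    case (elim x)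
    have "2 \<le> x div q" using elim q1 by (simp add: less_eq_div_iff_mult_less_eq)
    hence "ln (real (x div q)) > 0" by simp
    thus ?case by simp
  qed
  ultimately have "(\<lambda>x. H P (x div q) / ln (real x)) \<longlonglongrightarrow> \<alpha> * 1"
    by (rule Lim_transform_eventually)
  hence "(\<lambda>x. H P (x div q) / ln (real x)) \<longlonglongrightarrow> \<alpha>" by simp
  hence "(\<lambda>x. H P x / ln (real x) - (1 / q) * (H P (x div q) / ln (real x))) \<longlonglongrightarrow> \<alpha> - (1 / q) * \<alpha>"
    by (intro tendsto_diff IH tendsto_mult tendsto_const)
  moreover have "\<alpha> - (1 / q) * \<alpha> = (\<Prod>p\<in>insert q P. 1 - 1 / real p)"
    using insert by (simp add: \<alpha>_def algebra_simps)
  ultimately show ?case unfolding H rec by (simp add: diff_divide_distrib)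
qed

text \<open>Interchange the summations: each d has \<open>x div d\<close> multiples up to x.\<close>

lemma sum_card_rough_divisors_le:
  fixes P :: "nat set"
  shows "(\<Sum>n\<in>{1..x}. real (card {d. d dvd n \<and> (\<forall>p\<in>P. \<not> p dvd d)}))
           \<le> real x * (\<Sum>n | n \<in> {1..x} \<and> (\<forall>p\<in>P. \<not> p dvd n). 1 / real n)"
proof -
  let ?R = "{d. d \<in> {1..x} \<and> (\<forall>p\<in>P. \<not> p dvd d)}"
  have "(\<Sum>n\<in>{1..x}. real (card {d. d dvd n \<and> (\<forall>p\<in>P. \<not> p dvd d)}))
     = (\<Sum>n\<in>{1..x}. \<Sum>d\<in>?R. if d dvd n then 1 else 0)"
  proof (intro sum.cong refl)
    fix n assume "n \<in> {1..x}"
    hence "{d. d dvd n \<and> (\<forall>p\<in>P. \<not> p dvd d)} = {d \<in> ?R. d dvd n}"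
      by (auto dest: dvd_imp_le intro: Nat.gr0I)
    thus "real (card {d. d dvd n \<and> (\<forall>p\<in>P. \<not> p dvd d)}) = (\<Sum>d\<in>?R. if d dvd n then 1 else 0)"
      by (simp add: sum.If_cases Int_def)
  qed
  also have "\<dots> = (\<Sum>d\<in>?R. \<Sum>n\<in>{1..x}. if d dvd n then 1 else 0)" by (rule sum.swap)
  also have "\<dots> \<le> (\<Sum>d\<in>?R. real x * (1 / real d))"
  proof (intro sum_mono)
    fix d assume "d \<in> ?R"
    hence d: "d > 0" by auto
    have "(\<Sum>n\<in>{1..x}. if d dvd n then 1 else (0::real)) = (\<Sum>n | n \<in> {1..x} \<and> d dvd n. 1)"
      by (subst sum.inter_filter[symmetric]) auto
    also have "\<dots> = real (x div d)" using sum_multiples[OF d, of "\<lambda>_. 1::real" x] by simp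
    also have "\<dots> \<le> real x * (1 / real d)" using of_nat_div_le_of_nat[of x d] by simp
    finally show "(\<Sum>n\<in>{1..x}. if d dvd n then 1 else (0::real)) \<le> real x * (1 / real d)" .
  qed
  finally show ?thesis by (simp add: sum_distrib_left)
qed

text \<open>One prime q at a time: a divisor d is determined by its q-multiplicity, which has at
  most \<open>1 + multiplicity q n\<close> values, and by its q-free part.\<close>

lemma card_divisors_le_rough:
  fixes P :: "nat set"
  assumes "finite P" "\<And>p. p \<in> P \<Longrightarrow> prime p" "n > 0"
  shows "card {d. d dvd n} \<le>
           (\<Prod>p\<in>P. 1 + multiplicity p n) * card {d. d dvd n \<and> (\<forall>p\<in>P. \<not> p dvd d)}"
  using assms(1,2)
proof (induction P rule: finite_induct)
  case empty
  show ?case by simp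
next
  case (insert q P)
  have q: "prime q" using insert by auto
  hence nu: "\<not> is_unit q" by auto
  let ?B = "\<lambda>R. {d. d dvd n \<and> (\<forall>p\<in>R. \<not> p dvd d)}"
  let ?f = "\<lambda>d. (multiplicity q d, d div q ^ multiplicity q d)"
  have fin: "finite (?B R)" for R using \<open>n > 0\<close> by simp
  have "inj_on ?f (?B P)"
  proof (rule inj_onI)
    fix a b assume "?f a = ?f b"
    thus "a = b" by (metis Pair_inject dvd_mult_div_cancel multiplicity_dvd)
  qed
  moreover have "?f ` ?B P \<subseteq> {..multiplicity q n} \<times> ?B (insert q P)"
  proof
    fix z assume "z \<in> ?f ` ?B P"
    then obtain d where d: "d dvd n" "\<forall>p\<in>P. \<not> p dvd d" "z = ?f d" by auto
    hence d0: "d \<noteq> 0" using \<open>n > 0\<close> by auto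
    have dv: "d div q ^ multiplicity q d dvd d"
      by (metis dvd_div_mult_self multiplicity_dvd dvd_triv_left)
    have "multiplicity q d \<le> multiplicity q n"
      using d \<open>n > 0\<close> by (intro dvd_imp_multiplicity_le) auto
    moreover have "\<not> q dvd d div q ^ multiplicity q d"
      using multiplicity_decompose[OF d0 nu] .
    ultimately show "z \<in> {..multiplicity q n} \<times> ?B (insert q P)"
      using d dv by (auto intro: dvd_trans)
  qed
  ultimately have "card (?B P) \<le> card ({..multiplicity q n} \<times> ?B (insert q P))"
    by (rule card_inj_on_le) (intro finite_cartesian_product fin finite_atMost)
  also have "\<dots> = (1 + multiplicity q n) * card (?B (insert q P))"
    by (simp add: card_cartesian_product)
  finally have le: "card (?B P) \<le> (1 + multiplicity q n) * card (?B (insert q P))" .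
  have "card {d. d dvd n} \<le> (\<Prod>p\<in>P. 1 + multiplicity p n) * card (?B P)"
    using insert by auto
  also have "\<dots> \<le> (\<Prod>p\<in>P. 1 + multiplicity p n) * ((1 + multiplicity q n) * card (?B (insert q P)))"
    using le by (intro mult_left_mono) auto
  also have "\<dots> = (\<Prod>p\<in>insert q P. 1 + multiplicity p n) * card (?B (insert q P))"
    using insert by (simp add: algebra_simps)
  finally show ?case .
qed

section \<open>Choice of the primes\<close>

lemma exists_primes_small_product:
  assumes "\<rho> > 0"
  shows "\<exists>P::nat set. finite P \<and> (\<forall>p\<in>P. prime p) \<and>
    (\<Prod>p\<in>P. 1 + 5 / 12 / (real p - 1))\<^sup>2 * (\<Prod>p\<in>P. 1 - 1 / real p) \<le> \<rho>"
proof -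
  obtain N where N: "- 13 * ln \<rho> < (\<Sum>p | prime p \<and> p \<noteq> 2 \<and> p \<le> N. 1 / real p)"
    using sum_inverse_odd_primes_unbounded by blast
  \<comment> \<open>The prime 2 is excluded because its factor would be (17/12)^2 / 2 = 289/288 >
    1.\<close>
  let ?P = "{p. prime p \<and> p \<noteq> 2 \<and> p \<le> N}"
  have "(\<Prod>p\<in>?P. 1 + 5 / 12 / (real p - 1))\<^sup>2 * (\<Prod>p\<in>?P. 1 - 1 / real p)
     = (\<Prod>p\<in>?P. (1 + 5 / 12 / (real p - 1))\<^sup>2 * (1 - 1 / real p))"
    by (simp add: prod.distrib prod_power_distrib)
  also have "\<dots> \<le> (\<Prod>p\<in>?P. exp (- (1 / 13) * (1 / real p)))"
  proof (intro prod_mono conjI)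
    fix p assume "p \<in> ?P"
    hence "p \<ge> 2" "p \<noteq> 2" using prime_ge_2_nat by auto
    hence p: "real p \<ge> 3" by linarith
    thus "0 \<le> (1 + 5 / 12 / (real p - 1))\<^sup>2 * (1 - 1 / real p)" by simp
    \<comment> \<open>In terms of u, \<open>1 - 1 / p\<close> is 1/(1 + u), and p >= 3 means u <=
      1/2. Then (1 + 5u/12)^2 <= 1 + 265u/288, and 23/288 > 1/13 is the source of the 13.\<close>
    define u where "u = 1 / (real p - 1)"
    have u: "0 < u" "u \<le> 1 / 2" using p by (auto simp: u_def field_simps)
    have pu: "real p = (1 + u) / u" using p by (simp add: u_def field_simps)
    have "5 / 12 / (real p - 1) = 5 / 12 * u" by (simp add: u_def)
    hence "(1 + 5 / 12 / (real p - 1))\<^sup>2 * (1 - 1 / real p) = (1 + 5 / 12 * u)\<^sup>2 / (1 + u)"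
      using u by (simp add: pu field_simps)
    also have "\<dots> \<le> (1 + u - u / 13) / (1 + u)"
    proof (intro divide_right_mono)
      have "u * u \<le> u * (1 / 2)" using u by (intro mult_left_mono) auto
      moreover have "(1 + 5 / 12 * u)\<^sup>2 = 1 + 5 / 6 * u + 25 / 144 * (u * u)"
        by (simp add: power2_eq_square field_simps)
      ultimately show "(1 + 5 / 12 * u)\<^sup>2 \<le> 1 + u - u / 13" using u by linarith
    qed (use u in auto)
    also have "\<dots> = 1 - (1 / 13) * (1 / real p)" using u by (simp add: pu field_simps)
    also have "\<dots> \<le> exp (- (1 / 13) * (1 / real p))"
      using exp_ge_add_one_self[of "- (1 / 13) * (1 / real p)"] by simp
    finally show "(1 + 5 / 12 / (real p - 1))\<^sup>2 * (1 - 1 / real p) \<le> exp (- (1 / 13) * (1 / real p))" .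
  qed
  also have "\<dots> = exp (- (1 / 13) * (\<Sum>p\<in>?P. 1 / real p))"
    by (simp only: exp_sum sum_distrib_left) (simp add: exp_sum)
  also have "\<dots> \<le> exp (ln \<rho>)" using N by simp
  also have "\<dots> = \<rho>" using assms by simp
  finally show ?thesis by (intro exI[of _ ?P]) auto
qed

section \<open>Integers with many divisors have density zero\<close>

lemma card_markov_le:
  fixes f :: "'a \<Rightarrow> real"
  assumes "finite A" "\<And>n. n \<in> A \<Longrightarrow> f n \<ge> 0" "t > 0"
  shows "real (card {n \<in> A. t \<le> f n}) \<le> (\<Sum>n\<in>A. f n) / t"
proof -
  have "real (card {n \<in> A. t \<le> f n}) * t = (\<Sum>n | n \<in> A \<and> t \<le> f n. t)" by simp
  also have "\<dots> \<le> (\<Sum>n | n \<in> A \<and> t \<le> f n. f n)" by (intro sum_mono) auto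
  also have "\<dots> \<le> (\<Sum>n\<in>A. f n)" using assms by (intro sum_mono2) auto
  finally show ?thesis using assms by (simp add: field_simps)
qed

lemma density_many_divisors_zero:
  assumes "c > 0"
  shows "(\<lambda>x. real (card {n \<in> {1..x}. c * ln (real n) \<le> real (card {d. d dvd n})}) / real x)
           \<longlonglongrightarrow> 0"
proof (rule LIMSEQ_I)
  fix \<epsilon> :: real assume \<epsilon>: "\<epsilon> > 0"
  \<comment> \<open>Chosen to balance the two Markov bounds. With
    \<open>k\<^sup>2 = \<eta> / \<alpha>\<close>, the bound on \<open>P\<close> gives
    \<open>A / k \<le> \<epsilon> / 4\<close>, while the bound for \<open>B\<close> becomes
    \<open>4 * \<eta> / c = \<epsilon> / 4\<close>, both relative to x.\<close>
  define \<eta> where "\<eta> = \<epsilon> * c / 16"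
  have \<eta>: "\<eta> > 0" using \<epsilon> assms by (simp add: \<eta>_def)
  obtain P :: "nat set" where P: "finite P" "\<And>p. p \<in> P \<Longrightarrow> prime p"
    and rho: "(\<Prod>p\<in>P. 1 + 5 / 12 / (real p - 1))\<^sup>2 * (\<Prod>p\<in>P. 1 - 1 / real p) \<le> \<eta> * (\<epsilon> / 4)\<^sup>2"
    using exists_primes_small_product[of "\<eta> * (\<epsilon> / 4)\<^sup>2"] \<eta> \<epsilon> by auto
  define A where "A = (\<Prod>p\<in>P. 1 + 5 / 12 / (real p - 1))"
  define \<alpha> where "\<alpha> = (\<Prod>p\<in>P. 1 - 1 / real p)"
  define F where "F = (\<lambda>n. \<Prod>p\<in>P. 1 + 5 / 12 * real (multiplicity p n))"
  define B where "B = (\<lambda>n. real (card {d. d dvd n \<and> (\<forall>p\<in>P. \<not> p dvd d)}))"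
  define H where "H = (\<lambda>x. \<Sum>n | n \<in> {1..x} \<and> (\<forall>p\<in>P. \<not> p dvd n). 1 / real n)"
  have \<alpha>: "\<alpha> > 0" unfolding \<alpha>_def
  proof (intro prod_pos)
    fix p assume "p \<in> P"
    hence "p > 1" by (intro prime_gt_1_nat P)
    thus "0 < 1 - 1 / real p" by simp
  qed
  define k where "k = sqrt (\<eta> / \<alpha>)"
  have k: "k > 0" "k\<^sup>2 = \<eta> / \<alpha>" using \<eta> \<alpha> by (auto simp: k_def)
  have "A\<^sup>2 \<le> \<eta> * (\<epsilon> / 4)\<^sup>2 / \<alpha>" using rho \<alpha> by (simp add: A_def \<alpha>_def field_simps)
  also have "\<dots> = (\<epsilon> / 4 * k)\<^sup>2" unfolding power_mult_distrib k(2) by simp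
  finally have A: "A \<le> \<epsilon> / 4 * k" by (rule power2_le_imp_le) (use \<epsilon> k in simp)
  have F1: "F n \<ge> 1" for n unfolding F_def by (intro prod_ge_1) auto
  have tau: "real (card {d. d dvd n}) \<le> (F n)\<^sup>2 * B n" if "n > 0" for n
  proof -
    have "real (card {d. d dvd n}) \<le> real ((\<Prod>p\<in>P. 1 + multiplicity p n) *
        card {d. d dvd n \<and> (\<forall>p\<in>P. \<not> p dvd d)})"
      using card_divisors_le_rough[OF P that] by (rule of_nat_mono)
    also have "\<dots> = (\<Prod>p\<in>P. 1 + real (multiplicity p n)) * B n" by (simp add: B_def)
    also have "\<dots> \<le> (\<Prod>p\<in>P. (1 + 5 / 12 * real (multiplicity p n))\<^sup>2) * B n"
    proof (intro mult_right_mono prod_mono conjI)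
      fix p
      \<comment> \<open>After expanding the square, what remains is 24 m <= 25 m^2, which holds for
        natural m.\<close>
      have "real m \<le> real m * real m" for m by (cases m) (auto simp: algebra_simps)
      from this[of "multiplicity p n"]
      show "1 + real (multiplicity p n) \<le> (1 + 5 / 12 * real (multiplicity p n))\<^sup>2"
        by (simp add: power2_eq_square algebra_simps)
    qed (auto simp: B_def)
    finally show ?thesis by (simp add: F_def prod_power_distrib)
  qed
  have "(\<lambda>x. H x / ln (real x)) \<longlonglongrightarrow> \<alpha>"
    unfolding H_def \<alpha>_def by (rule sum_inverse_rough_asymp[OF P])
  hence ev1: "\<forall>\<^sub>F x in sequentially. H x / ln (real x) < 2 * \<alpha>"
    using \<alpha> by (intro order_tendstoD) auto
  have "(\<lambda>x::nat. 1 / sqrt (real x)) \<longlonglongrightarrow> 0" by real_asymp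
  hence ev2: "\<forall>\<^sub>F x::nat in sequentially. 1 / sqrt (real x) < \<epsilon> / 4"
    using \<epsilon> by (intro order_tendstoD) auto
  have "\<forall>\<^sub>F x in sequentially.
     norm (real (card {n \<in> {1..x}. c * ln (real n) \<le> real (card {d. d dvd n})}) / real x - 0) < \<epsilon>"
    using ev1 ev2 eventually_ge_at_top[of 2]
  proof eventually_elim
    case (elim x)
    have lnx: "ln (real x) > 0" using elim by simp
    define t where "t = c / 2 * ln (real x) / k\<^sup>2"
    have t: "t > 0" using lnx assms k(1) by (simp add: t_def)
    let ?E = "{n \<in> {1..x}. c * ln (real n) \<le> real (card {d. d dvd n})}"
    let ?S = "{1..nat \<lfloor>sqrt (real x)\<rfloor>}"
    let ?F = "{n \<in> {1..x}. k \<le> F n}" and ?B = "{n \<in> {1..x}. t \<le> B n}"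
    \<comment> \<open>If n exceeds \<open>sqrt x\<close>, then \<open>ln n\<close> is at least half
      of \<open>ln x\<close>. With \<open>F n < k\<close> and \<open>B n < t\<close> the number of
      divisors would be below \<open>k\<^sup>2 * t\<close>, and \<open>t\<close> is chosen to make
      this \<open>c / 2 * ln x\<close>.\<close>
    have sub: "?E \<subseteq> ?S \<union> ?F \<union> ?B"
    proof
      fix n assume "n \<in> ?E"
      hence n: "1 \<le> n" "n \<le> x" "c * ln (real n) \<le> real (card {d. d dvd n})" by auto
      show "n \<in> ?S \<union> ?F \<union> ?B"
      proof (rule ccontr)
        assume "n \<notin> ?S \<union> ?F \<union> ?B"
        hence *: "\<not> n \<le> nat \<lfloor>sqrt (real x)\<rfloor>" "F n < k" "B n < t" using n by auto
        have "sqrt (real x) < real n" using *(1) by linarith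
        hence "ln (sqrt (real x)) \<le> ln (real n)" using elim n by simp
        moreover have "ln (sqrt (real x)) = ln (real x) / 2" using elim by (simp add: ln_sqrt)
        ultimately have "c * (ln (real x) / 2) \<le> c * ln (real n)"
          using assms by (intro mult_left_mono) auto
        also have "\<dots> \<le> (F n)\<^sup>2 * B n" using n(3) tau[of n] n(1) by simp
        also have "\<dots> \<le> k\<^sup>2 * B n"
          using *(2) F1[of n] by (intro mult_right_mono power_mono) (auto simp: B_def)
        also have "\<dots> < k\<^sup>2 * t" using *(3) k(1) by (intro mult_strict_left_mono) auto
        also have "\<dots> = c * (ln (real x) / 2)" using k(1) by (simp add: t_def)
        finally show False by simp
      qed
    qed
    have "real (card ?E) \<le> real (card ?S + card ?F + card ?B)"
    proof (rule of_nat_mono)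
      have "card ?E \<le> card (?S \<union> ?F \<union> ?B)" using sub by (intro card_mono) auto
      also have "\<dots> \<le> card ?S + card ?F + card ?B"
        by (intro order_trans[OF card_Un_le] add_mono card_Un_le) auto
      finally show "card ?E \<le> card ?S + card ?F + card ?B" .
    qed
    also have "\<dots> = real (card ?S) + real (card ?F) + real (card ?B)" by simp
    also have "real (card ?S) \<le> real x * (\<epsilon> / 4)"
    proof -
      have "real (card ?S) \<le> sqrt (real x)" by (simp add: of_nat_nat)
      also have "\<dots> = real x * (1 / sqrt (real x))" by (simp add: real_div_sqrt)
      also have "\<dots> \<le> real x * (\<epsilon> / 4)" using elim by (intro mult_left_mono) auto
      finally show ?thesis .
    qed
    also have "real (card ?F) \<le> real x * (\<epsilon> / 4)"
    proof -
      have "real (card ?F) \<le> (\<Sum>n\<in>{1..x}. F n) / k"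
        using k F1 by (intro card_markov_le) (auto intro: order_trans[OF zero_le_one])
      also have "\<dots> \<le> (real x * A) / k"
        unfolding F_def A_def using k sum_prod_multiplicity_le[OF P, of "5 / 12" x]
        by (intro divide_right_mono) auto
      also have "\<dots> \<le> real x * (\<epsilon> / 4 * k) / k"
        using A k by (intro divide_right_mono mult_left_mono) auto
      finally show ?thesis using k by simp
    qed
    also have "real (card ?B) \<le> real x * (\<epsilon> / 4)"
    proof -
      have "real (card ?B) \<le> (\<Sum>n\<in>{1..x}. B n) / t"
        using t by (intro card_markov_le) (auto simp: B_def)
      also have "\<dots> \<le> (real x * H x) / t"
        unfolding B_def H_def using t sum_card_rough_divisors_le[of P x]
        by (intro divide_right_mono) auto
      also have "\<dots> \<le> real x * (2 * \<alpha> * ln (real x)) / t"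
        using elim lnx t by (intro divide_right_mono mult_left_mono) (auto simp: field_simps)
      also have "\<dots> = real x * (\<epsilon> / 4)"
        using lnx assms \<alpha> \<eta> \<epsilon> unfolding t_def k(2) by (simp add: \<eta>_def field_simps)
      finally show ?thesis .
    qed
    finally have "real (card ?E) \<le> real x * (3 / 4 * \<epsilon>)" by (simp add: algebra_simps)
    also have "\<dots> < real x * \<epsilon>" using elim \<epsilon> by (intro mult_strict_left_mono) auto
    finally show ?case using elim by (simp add: field_simps)
  qed
  thus "\<exists>no. \<forall>n\<ge>no. norm (real (card {na \<in> {1..n}. c * ln (real na) \<le> real (card {d. d dvd na})}) / real n - 0) < \<epsilon>"
    by (simp add: eventually_sequentially)
qed

section \<open>Application to s-practical numbers\<close>

text \<open>Pigeonhole: each of the \<open>S_s n\<close> targets needs its own set of divisors, and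
  there are only \<open>2 ^ card {d. d dvd n}\<close> such sets.\<close>

lemma s_practical_imp_le_power:
  assumes "s_practical n" "n > 0"
  shows "S_s n \<le> 2 ^ card {d. d dvd n}"
proof -
  have eq: "{d. 0 < d \<and> d dvd n} = {d. d dvd n}" using assms by (auto intro: Nat.gr0I)
  have fin: "finite {d. d dvd n}" using assms by simp
  have "{1..S_s n} \<subseteq> (\<lambda>D. \<Sum>d\<in>D. s_fun d) ` Pow {d. d dvd n}"
    using assms unfolding s_practical_def eq by auto
  hence "card {1..S_s n} \<le> card ((\<lambda>D. \<Sum>d\<in>D. s_fun d) ` Pow {d. d dvd n})"
    using fin by (intro card_mono) auto
  also have "\<dots> \<le> card (Pow {d. d dvd n})" using fin by (intro card_image_le) auto
  also have "\<dots> = 2 ^ card {d. d dvd n}" using fin by (rule card_Pow)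
  finally show ?thesis by simp
qed

lemma s_practical_imp_many_divisors:
  assumes "s_practical n" "n > 0" "sqrt (real n) \<le> real (S_s n)"
  shows "1 / 2 * ln (real n) \<le> real (card {d. d dvd n})"
proof -
  let ?k = "card {d. d dvd n}"
  have "real (S_s n) \<le> real (2 ^ ?k)"
    using s_practical_imp_le_power[OF assms(1,2)] by (rule of_nat_mono)
  with assms(3) have "sqrt (real n) \<le> real (2 ^ ?k)" by (rule order_trans)
  hence "sqrt (real n) \<le> 2 ^ ?k" by simp
  hence "ln (sqrt (real n)) \<le> ln (2 ^ ?k)" using assms(2) by simp
  hence "ln (real n) / 2 \<le> real ?k * ln 2" using assms(2) by (simp add: ln_sqrt ln_realpow)
  also have "\<dots> \<le> real ?k * 1" using ln_2_less_1 by (intro mult_left_mono) auto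
  finally show ?thesis by simp
qed

theorem theorem6p9:
  shows "(\<lambda>x::nat. real (card {n \<in> {1..x}. s_practical n \<and> sqrt (real n) \<le> real (S_s n)})
            / real x) \<longlonglongrightarrow> 0"
proof (rule tendsto_sandwich[where f = "\<lambda>_. 0"])
  show "(\<lambda>x. real (card {n \<in> {1..x}. 1 / 2 * ln (real n) \<le> real (card {d. d dvd n})}) / real x)
      \<longlonglongrightarrow> 0"
    by (rule density_many_divisors_zero) simp
  show "\<forall>\<^sub>F x in sequentially.
      real (card {n \<in> {1..x}. s_practical n \<and> sqrt (real n) \<le> real (S_s n)}) / real x
      \<le> real (card {n \<in> {1..x}. 1 / 2 * ln (real n) \<le> real (card {d. d dvd n})}) / real x"
  proof (intro always_eventually allI divide_right_mono of_nat_mono card_mono subsetI)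
    fix x n assume "n \<in> {n \<in> {1..x}. s_practical n \<and> sqrt (real n) \<le> real (S_s n)}"
    thus "n \<in> {n \<in> {1..x}. 1 / 2 * ln (real n) \<le> real (card {d. d dvd n})}"
      using s_practical_imp_many_divisors[of n] by auto
  qed auto
qed auto

end
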